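(* Let $p_0=x_0/y_0$ and $p_1=x_1/y_1$ be two distinct plants given by coprime factorizations with $x_i,y_i\in\mathbb{H}$ and $y_i$ proper but not strictly proper ($i=0,1$). Then $p_0$ and $p_1$ are simultaneously stabilized by a (single) proper compensator if and only if there exist $\delta_0,\delta_1\in\mathbb{J}$ satisfying both of the following conditions: (i) If $x_0y_1-x_1y_0$ has zeros at $s_1,\dots,s_t$ in $\mathbb{C}_+$ with multiplicities $m_1,\dots,m_t$ respectively, then $s_1,\dots,s_t$ are also zeros of $\delta_0y_1-\delta_1y_0$ and of $\delta_1x_0-\delta_0x_1$, with multiplicities not less than $m_1,\dots,m_t$ respectively. (ii) If $x_0y_1-x_1y_0=0$ at $\infty$ with multiplicity $m_\infty$, then $\delta_1x_0-\delta_0x_1=0$ at $\infty$ with the same multiplicity $m_\infty$.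
   Context: $\mathbb{C}_-$ is the open left half of the complex plane and $\mathbb{C}_+=(\mathbb{C}\setminus\mathbb{C}_-)\cup\{\infty\}$. $\mathbb{H}$ is the ring of proper rational functions in $s$ with real coefficients all of whose poles lie in $\mathbb{C}_-$, and $\mathbb{J}$ is the set of multiplicative units of $\mathbb{H}$. A proper rational function is not strictly proper if its value at $\infty$ is nonzero. Coprime means coprime in the ring $\mathbb{H}$. A proper compensator is a rational function $k=x_c/y_c$ with $x_c,y_c\in\mathbb{H}$ coprime and $y_c$ proper but not strictly proper. The closed-loop transfer function formed with the plant $p_i$ is $G_i=\dfrac{x_iy_c}{y_iy_c+x_ix_c}$. The compensator $k$ stabilizes $p_i=x_i/y_i$ if all zeros of $d_i=y_iy_c+x_ix_c$ lie in $\mathbb{C}_-$ and $d_i(\infty)\neq0$, i.e. if $x_ix_c+y_iy_c\in\mathbb{J}$. It simultaneously stabilizes $p_0$ and $p_1$ if it stabilizes both. *)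

theory Defs
  imports
    "HOL-Computational_Algebra.Computational_Algebra"
    "HOL-Computational_Algebra.Field_as_Ring"
    "HOL-Library.Extended_Nat"
    Complex_Main
begin

text \<open>
  A rational function in \<open>s\<close> with real coefficients is an element of the fraction field of
  \<open>\<real>[s]\<close>. The functions \<open>rf_num\<close> and \<open>rf_den\<close> select its representation in lowest terms, with
  monic denominator (so \<open>0\<close> is represented as \<open>0 / 1\<close>); hence the poles and zeros in the finite
  plane are exactly the complex roots of \<open>rf_den\<close> and \<open>rf_num\<close>.
\<close>

type_synonym ratfun = "real poly fract"

definition rf_num :: "ratfun \<Rightarrow> real poly" where
  "rf_num f = fst (quot_of_fract f)"

definition rf_den :: "ratfun \<Rightarrow> real poly" where
  "rf_den f = snd (quot_of_fract f)"

abbreviation cpoly :: "real poly \<Rightarrow> complex poly" where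
  "cpoly p \<equiv> map_poly complex_of_real p"

definition rf_pole :: "ratfun \<Rightarrow> complex \<Rightarrow> bool" where
  "rf_pole f s \<longleftrightarrow> poly (cpoly (rf_den f)) s = 0"

definition rf_proper :: "ratfun \<Rightarrow> bool" where
  "rf_proper f \<longleftrightarrow> degree (rf_num f) \<le> degree (rf_den f)"

text \<open>Meaningful for proper \<open>f\<close> only, where it is the limit of \<open>f s\<close> as \<open>s\<close> tends to infinity.\<close>

definition rf_at_inf :: "ratfun \<Rightarrow> real" where
  "rf_at_inf f = coeff (rf_num f) (degree (rf_den f)) / lead_coeff (rf_den f)"

datatype ext_complex = Pt complex | PtInf

definition C_minus :: "complex set" where
  "C_minus = {s. Re s < 0}"

definition C_plus :: "ext_complex set" where
  "C_plus = Pt ` (- C_minus) \<union> {PtInf}"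

fun rf_zero :: "ratfun \<Rightarrow> ext_complex \<Rightarrow> bool" where
  "rf_zero f (Pt s) \<longleftrightarrow> poly (cpoly (rf_num f)) s = 0"
| "rf_zero f PtInf \<longleftrightarrow> rf_proper f \<and> rf_at_inf f = 0"

text \<open>
  At infinity, the multiplicity of a zero of a proper rational function is its relative degree.
  The zero function vanishes to infinite order everywhere. For \<open>f \<noteq> 0\<close>, the value is \<open>0\<close> at
  points that are not zeros of \<open>f\<close>.
\<close>

fun rf_mult :: "ratfun \<Rightarrow> ext_complex \<Rightarrow> enat" where
  "rf_mult f (Pt s) = (if f = 0 then \<infinity> else enat (order s (cpoly (rf_num f))))"
| "rf_mult f PtInf = (if f = 0 then \<infinity> else enat (degree (rf_den f) - degree (rf_num f)))"

definition H_ring :: "ratfun set" where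
  "H_ring = {f. rf_proper f \<and> (\<forall>s. rf_pole f s \<longrightarrow> s \<in> C_minus)}"

definition J_units :: "ratfun set" where
  "J_units = {u \<in> H_ring. \<exists>v\<in>H_ring. u * v = 1}"

text \<open>
  Divisibility within \<open>H_ring\<close>; the library's \<open>dvd\<close> on \<open>ratfun\<close> is the trivial one of a
  field. \<open>H_coprime\<close> is the library definition of \<open>coprime\<close> (every common divisor is a unit),
  relativised to \<open>H_ring\<close>.
\<close>

definition H_dvd :: "ratfun \<Rightarrow> ratfun \<Rightarrow> bool" where
  "H_dvd d x \<longleftrightarrow> (\<exists>q\<in>H_ring. x = d * q)"

definition H_coprime :: "ratfun \<Rightarrow> ratfun \<Rightarrow> bool" where
  "H_coprime x y \<longleftrightarrow> (\<forall>d\<in>H_ring. H_dvd d x \<longrightarrow> H_dvd d y \<longrightarrow> d \<in> J_units)"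

text \<open>
  \<open>rf_at_inf y \<noteq> 0\<close> says that \<open>y\<close> is proper but not strictly proper; in particular \<open>y \<noteq> 0\<close>.
\<close>

definition coprime_factorization :: "ratfun \<Rightarrow> ratfun \<Rightarrow> ratfun \<Rightarrow> bool" where
  "coprime_factorization p x y \<longleftrightarrow>
     x \<in> H_ring \<and> y \<in> H_ring \<and> H_coprime x y \<and> rf_at_inf y \<noteq> 0 \<and> p = x / y"

definition proper_compensator :: "ratfun \<Rightarrow> bool" where
  "proper_compensator k \<longleftrightarrow> (\<exists>xc yc. coprime_factorization k xc yc)"

text \<open>
  The denominator \<open>y * yc + x * xc\<close> of the closed-loop transfer function
  \<open>x * yc / (y * yc + x * xc)\<close> has all its zeros in the open left half plane and does not vanish
  at infinity. Coprime factorizations in \<open>H_ring\<close> are unique up to a common unit factor, so the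
  condition does not depend on the chosen factorizations.
\<close>

definition stabilizes :: "ratfun \<Rightarrow> ratfun \<Rightarrow> bool" where
  "stabilizes k p \<longleftrightarrow>
     (\<exists>xc yc x y. coprime_factorization k xc yc \<and> coprime_factorization p x y \<and>
        (let d = y * yc + x * xc in
           (\<forall>s. rf_zero d (Pt s) \<longrightarrow> s \<in> C_minus) \<and> rf_at_inf d \<noteq> 0))"

end

theory Submission
  imports Defs
begin

text \<open>
  \<open>H_ring\<close> consists of the functions with nonnegative valuation at every point of \<open>C_plus\<close>, and its
  units are those with valuation zero there. A compensator \<open>xc / yc\<close> stabilizes both plants iff the
  two denominators \<open>\<delta>0 = y0 * yc + x0 * xc\<close> and \<open>\<delta>1 = y1 * yc + x1 * xc\<close> are units. With
  \<open>D = x0 * y1 - x1 * y0\<close>, Cramer's rule turns this linear system into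
  \<open>\<delta>0 * y1 - \<delta>1 * y0 = D * xc\<close> and \<open>\<delta>1 * x0 - \<delta>0 * x1 = D * yc\<close>, so its solvability in \<open>H_ring\<close> is a
  condition on the valuations of both sides.
\<close>

section \<open>Valuations of real polynomials at points of the extended plane\<close>

lemma cpoly_add: "cpoly (p + q) = cpoly p + cpoly q"
  by (rule poly_eqI) (simp add: coeff_map_poly)

lemma cpoly_mult: "cpoly (p * q) = cpoly p * cpoly q"
  by (rule poly_eqI) (simp add: coeff_map_poly coeff_mult)

lemma cpoly_smult: "cpoly (smult c p) = smult (complex_of_real c) (cpoly p)"
  by (rule poly_eqI) (simp add: coeff_map_poly)

lemma cpoly_1: "cpoly 1 = 1"
  by (simp add: map_poly_1)

lemma cpoly_eq_0_iff: "cpoly p = 0 \<longleftrightarrow> p = 0"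
  by (simp add: map_poly_eq_0_iff)

lemma degree_cpoly: "degree (cpoly p) = degree p"
  by (rule degree_map_poly) simp

lemma order_add_ge:
  fixes p q :: "'a::idom poly"
  assumes "p + q \<noteq> 0" "p \<noteq> 0" "q \<noteq> 0"
  shows "min (order a p) (order a q) \<le> order a (p + q)"
proof -
  have "[:-a, 1:] ^ min (order a p) (order a q) dvd p + q"
    by (rule dvd_add) (simp_all add: order_divides)
  with assms(1) show ?thesis
    by (simp add: order_divides)
qed

text \<open>Infinity gets minus the degree, so that numerator minus denominator yields the relative
  degree. The values are integers to make such differences meaningful.\<close>

fun pval :: "real poly \<Rightarrow> ext_complex \<Rightarrow> int" where
  "pval p (Pt s) = int (order s (cpoly p))"
| "pval p PtInf = - int (degree p)"

lemma pval_mult: "p \<noteq> 0 \<Longrightarrow> q \<noteq> 0 \<Longrightarrow> pval (p * q) s = pval p s + pval q s"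
  by (cases s) (simp_all add: cpoly_mult order_mult cpoly_eq_0_iff degree_mult_eq)

lemma pval_add_ge:
  assumes "p \<noteq> 0" "q \<noteq> 0" "p + q \<noteq> 0"
  shows "min (pval p s) (pval q s) \<le> pval (p + q) s"
proof (cases s)
  case (Pt z)
  have "cpoly p + cpoly q \<noteq> 0"
    using assms(3) by (simp flip: cpoly_add add: cpoly_eq_0_iff)
  from order_add_ge[OF this, of z] assms show ?thesis
    by (simp add: Pt cpoly_add cpoly_eq_0_iff min_def split: if_splits)
next
  case PtInf
  with degree_add_le_max[of p q] show ?thesis by simp
qed

section \<open>Valuations of rational functions\<close>

definition val :: "ratfun \<Rightarrow> ext_complex \<Rightarrow> int" where
  "val f s = pval (rf_num f) s - pval (rf_den f) s"

lemma rf_den_nz [simp]: "rf_den f \<noteq> 0"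
  by (simp add: rf_den_def)

lemma rf_num_eq_0_iff [simp]: "rf_num f = 0 \<longleftrightarrow> f = 0"
  by (metis rf_num_def fst_conv fst_quot_of_fract_0_imp prod.collapse quot_of_fract_0 
      quot_to_fract_quot_of_fract)

lemma rf_eq: "to_fract (rf_num f) / to_fract (rf_den f) = f"
  using quot_to_fract_quot_of_fract[of f]
  by (simp add: rf_num_def rf_den_def quot_to_fract_def Fract_conv_to_fract case_prod_unfold)

text \<open>Cross-multiplying with the reduced representation gives an identity of polynomials, on
  which \<open>pval\<close> is additive. Valuations can thus be computed from any representation,
  without reducing to lowest terms.\<close>

lemma val_quot:
  assumes "a \<noteq> 0" "b \<noteq> 0"
  shows "val (to_fract a / to_fract b) s = pval a s - pval b s"
proof -
  define f where "f = to_fract a / to_fract b"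
  have "f \<noteq> 0" using assms by (simp add: f_def)
  have "to_fract (rf_num f) / to_fract (rf_den f) = to_fract a / to_fract b"
    by (simp add: rf_eq) (simp add: f_def)
  then have "to_fract (rf_num f * b) = to_fract (a * rf_den f)"
    using assms by (simp add: frac_eq_eq)
  then have "rf_num f * b = a * rf_den f"
    by (simp only: to_fract_eq_iff)
  then have "pval (rf_num f * b) s = pval (a * rf_den f) s"
    by simp
  with assms \<open>f \<noteq> 0\<close> show ?thesis
    by (simp add: pval_mult val_def flip: f_def)
qed

lemma val_mult:
  assumes "f \<noteq> 0" "g \<noteq> 0"
  shows "val (f * g) s = val f s + val g s"
proof -
  have "f * g = to_fract (rf_num f * rf_num g) / to_fract (rf_den f * rf_den g)"
    using rf_eq[of f] rf_eq[of g] by (metis times_divide_times_eq to_fract_mult)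
  with assms show ?thesis
    by (simp only:) (subst val_quot, simp_all add: pval_mult val_def)
qed

lemma val_1 [simp]: "val 1 s = 0"
  by (cases s) (simp_all add: val_def rf_num_def rf_den_def)

lemma val_divide: 
  assumes "f \<noteq> 0" "g \<noteq> 0"
  shows "val (f / g) s = val f s - val g s"
  using val_mult[of "f / g" g s] assms by simp

lemma val_add_ge:
  assumes "f \<noteq> 0" "g \<noteq> 0" "f + g \<noteq> 0"
  shows "min (val f s) (val g s) \<le> val (f + g) s"
proof -
  define a b c d where "a = rf_num f" "b = rf_den f" "c = rf_num g" "d = rf_den g"
  have f: "f = to_fract a / to_fract b" and g: "g = to_fract c / to_fract d"
    by (simp_all add: a_b_c_d_def rf_eq)
  have nz: "a \<noteq> 0" "b \<noteq> 0" "c \<noteq> 0" "d \<noteq> 0"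
    using assms by (simp_all add: a_b_c_d_def)
  have fg: "f + g = to_fract (a * d + c * b) / to_fract (b * d)"
    using nz by (simp add: f g field_simps)
  with assms(3) have "to_fract (a * d + c * b) \<noteq> 0"
    by (metis div_0)
  then have nz': "a * d + c * b \<noteq> 0"
    by (simp only: to_fract_eq_0_iff not_False_eq_True)
  have "min (pval (a * d) s) (pval (c * b) s) \<le> pval (a * d + c * b) s"
    by (rule pval_add_ge) (use nz nz' in auto)
  then have "min (pval (a * d) s) (pval (c * b) s) - pval (b * d) s \<le> val (f + g) s"
    using nz nz' by (simp only: fg) (subst val_quot, auto)
  moreover have "val f s = pval (a * d) s - pval (b * d) s" 
    "val g s = pval (c * b) s - pval (b * d) s"
    using nz by (simp_all add: f g val_quot pval_mult)
  ultimately show ?thesis by simp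
qed

section \<open>Poles, zeros and multiplicities in terms of valuations\<close>

lemma poly_cpoly_gcd_eq_0:
  assumes "poly (cpoly p) s = 0" "poly (cpoly q) s = 0"
  shows "poly (cpoly (gcd p q)) s = 0"
proof -
  obtain u v where "u * p + v * q = gcd p q"
    by (metis bezout_coefficients_fst_snd)
  then have "cpoly u * cpoly p + cpoly v * cpoly q = cpoly (gcd p q)"
    by (simp flip: cpoly_mult cpoly_add)
  then have "poly (cpoly u * cpoly p + cpoly v * cpoly q) s = poly (cpoly (gcd p q)) s"
    by simp
  with assms show ?thesis by simp
qed

lemma order_cpoly_eq_0_iff: "p \<noteq> 0 \<Longrightarrow> order s (cpoly p) = 0 \<longleftrightarrow> poly (cpoly p) s \<noteq> 0"
  by (simp add: order_eq_0_iff cpoly_eq_0_iff)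

text \<open>Coprimality over the reals survives at complex points, because a real Bezout identity
  can be evaluated there. So nothing cancels in \<open>val\<close>: its positive part is the order
  of the zero and its negative part that of the pole.\<close>

lemma order_num_or_den:
  assumes "f \<noteq> 0"
  shows "order s (cpoly (rf_num f)) = 0 \<or> order s (cpoly (rf_den f)) = 0"
proof -
  have "gcd (rf_num f) (rf_den f) = 1"
    by (simp add: rf_num_def rf_den_def coprime_quot_of_fract)
  with poly_cpoly_gcd_eq_0[of "rf_num f" s "rf_den f"] assms show ?thesis
    by (auto simp: order_cpoly_eq_0_iff cpoly_1)
qed

lemma rf_pole_iff: "rf_pole f s \<longleftrightarrow> f \<noteq> 0 \<and> val f (Pt s) < 0"
proof (cases "f = 0")
  case True
  then show ?thesis by (simp add: rf_pole_def rf_den_def)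
next
  case False
  with order_num_or_den[of f s] show ?thesis
    using order_cpoly_eq_0_iff[of "rf_den f" s] by (auto simp: rf_pole_def val_def)
qed

lemma rf_proper_iff: "rf_proper f \<longleftrightarrow> f = 0 \<or> 0 \<le> val f PtInf"
  by (auto simp: rf_proper_def val_def)
     (metis degree_0 le0 rf_num_eq_0_iff)

lemma val_zero_iff_at_inf: "f \<noteq> 0 \<Longrightarrow> rf_proper f \<Longrightarrow> rf_at_inf f = 0 \<longleftrightarrow> 0 < val f PtInf"
  unfolding rf_proper_def rf_at_inf_def val_def
  by (cases "degree (rf_num f) = degree (rf_den f)")
     (auto simp: coeff_eq_0, metis leading_coeff_0_iff rf_num_eq_0_iff)

lemma rf_at_inf_0 [simp]: "rf_at_inf 0 = 0"
  by (simp add: rf_at_inf_def rf_num_def rf_den_def)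

lemma rf_zero_iff: "rf_zero f s \<longleftrightarrow> f = 0 \<or> 0 < val f s"
proof (cases "f = 0")
  case True
  then show ?thesis by (cases s) (simp_all add: rf_proper_iff, simp add: rf_num_def)
next
  case False
  show ?thesis
  proof (cases s)
    case (Pt z)
    with False order_num_or_den[of f z] show ?thesis
      using order_cpoly_eq_0_iff[of "rf_num f" z] by (auto simp: val_def)
  next
    case PtInf
    with False val_zero_iff_at_inf[of f] show ?thesis
      by (auto simp: rf_proper_iff)
  qed
qed

text \<open>Both sides truncate at 0: at a finite pole the numerator has order 0, and at infinity
  the subtraction of degrees is one of natural numbers.\<close>

lemma rf_mult_eq: "f \<noteq> 0 \<Longrightarrow> rf_mult f s = enat (nat (val f s))"
proof (cases s)
  case (Pt z)
  assume "f \<noteq> 0"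
  with Pt order_num_or_den[of f z] show ?thesis
    by (auto simp: val_def)
next
  case PtInf
  assume "f \<noteq> 0"
  with PtInf show ?thesis by (simp add: val_def nat_diff_distrib')
qed

section \<open>The ring \<open>H_ring\<close> and its units\<close>

lemma mem_H_ring_iff: "f \<in> H_ring \<longleftrightarrow> f = 0 \<or> (\<forall>s\<in>C_plus. 0 \<le> val f s)"
  by (auto simp: H_ring_def rf_proper_iff rf_pole_iff C_plus_def) (meson ComplI not_less)+

lemma H_ringD: "f \<in> H_ring \<Longrightarrow> f \<noteq> 0 \<Longrightarrow> s \<in> C_plus \<Longrightarrow> 0 \<le> val f s"
  by (simp add: mem_H_ring_iff)

lemma H_ring_0 [simp]: "0 \<in> H_ring"
  by (simp add: mem_H_ring_iff)

lemma H_ringI: "(\<And>s. f \<noteq> 0 \<Longrightarrow> s \<in> C_plus \<Longrightarrow> 0 \<le> val f s) \<Longrightarrow> f \<in> H_ring"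
  by (auto simp: mem_H_ring_iff)

lemma H_ring_add:
  assumes "f \<in> H_ring" "g \<in> H_ring"
  shows "f + g \<in> H_ring"
proof (cases "f = 0 \<or> g = 0")
  case True
  with assms show ?thesis by auto
next
  case False
  show ?thesis
  proof (rule H_ringI)
    fix s assume "f + g \<noteq> 0" "s \<in> C_plus"
    with False val_add_ge[of f g s] H_ringD[OF assms(1), of s] H_ringD[OF assms(2), of s]
    show "0 \<le> val (f + g) s" by linarith
  qed
qed

lemma H_ring_mult:
  assumes "f \<in> H_ring" "g \<in> H_ring"
  shows "f * g \<in> H_ring"
proof (rule H_ringI)
  fix s assume "f * g \<noteq> 0" "s \<in> C_plus"
  with H_ringD[OF assms(1), of s] H_ringD[OF assms(2), of s] show "0 \<le> val (f * g) s"
    by (simp add: val_mult)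
qed

definition rf_const :: "real \<Rightarrow> ratfun" where
  "rf_const c = to_fract [:c:]"

lemma rf_const_eq_0_iff [simp]: "rf_const c = 0 \<longleftrightarrow> c = 0"
  by (simp add: rf_const_def)

lemma val_const: "c \<noteq> 0 \<Longrightarrow> val (rf_const c) s = 0"
  using val_quot[of "[:c:]" 1 s]
  by (cases s) (simp_all add: rf_const_def cpoly_1 map_poly_pCons order_0I)

lemma H_ring_const: "rf_const c \<in> H_ring"
  by (cases "c = 0") (simp_all add: mem_H_ring_iff val_const)

lemma rf_const_minus_1: "rf_const (- 1) = - 1"
proof -
  have "[:- 1:] = - (1 :: real poly)" by (simp add: one_pCons)
  then show ?thesis by (simp add: rf_const_def)
qed

lemma H_ring_diff: "f \<in> H_ring \<Longrightarrow> g \<in> H_ring \<Longrightarrow> f - g \<in> H_ring"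
  using H_ring_add[of f "rf_const (-1) * g"] H_ring_mult[OF H_ring_const, of g "-1"]
  by (simp add: rf_const_minus_1)

text \<open>The valuations of a unit and of its inverse are nonnegative on \<open>C_plus\<close> and
  add up to 0.\<close>

lemma mem_J_units_iff: "u \<in> J_units \<longleftrightarrow> u \<noteq> 0 \<and> (\<forall>s\<in>C_plus. val u s = 0)"
proof
  assume "u \<in> J_units"
  then obtain v where uv: "u \<in> H_ring" "v \<in> H_ring" "u * v = 1"
    by (auto simp: J_units_def)
  then have nz: "u \<noteq> 0" "v \<noteq> 0" by auto
  have "val u s = 0" if "s \<in> C_plus" for s
    using val_mult[OF nz, of s] H_ringD[OF uv(1) nz(1) that] H_ringD[OF uv(2) nz(2) that]
    by (simp add: uv(3))
  with nz show "u \<noteq> 0 \<and> (\<forall>s\<in>C_plus. val u s = 0)" by blast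
next
  assume u: "u \<noteq> 0 \<and> (\<forall>s\<in>C_plus. val u s = 0)"
  then have "u \<in> H_ring" "1 / u \<in> H_ring" "u * (1 / u) = 1"
    by (simp_all add: mem_H_ring_iff val_divide)
  then show "u \<in> J_units"
    unfolding J_units_def by blast
qed

lemma J_units_imp_H_ring: "u \<in> J_units \<Longrightarrow> u \<in> H_ring"
  by (simp add: J_units_def)

lemma J_units_mult: "u \<in> J_units \<Longrightarrow> v \<in> J_units \<Longrightarrow> u * v \<in> J_units"
  by (simp add: mem_J_units_iff val_mult)

lemma J_units_divide: "u \<in> J_units \<Longrightarrow> v \<in> J_units \<Longrightarrow> u / v \<in> J_units"
  by (simp add: mem_J_units_iff val_divide)

lemma J_units_factor:
  assumes "u * v \<in> J_units" "u \<in> H_ring" "v \<in> H_ring"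
  shows "u \<in> J_units"
proof -
  have nz: "u \<noteq> 0" "v \<noteq> 0" using assms(1) by (auto simp: mem_J_units_iff)
  have "val u s = 0" if "s \<in> C_plus" for s
    using val_mult[OF nz, of s] H_ringD[OF assms(2) nz(1) that] H_ringD[OF assms(3) nz(2) that]
      assms(1) that by (simp add: mem_J_units_iff)
  with nz show ?thesis by (simp add: mem_J_units_iff)
qed

declare rf_zero.simps [simp del] rf_mult.simps [simp del]

text \<open>Translates the closed-loop condition of \<open>stabilizes\<close>: valuations on
  \<open>C_plus\<close> are already nonnegative, so the absence of zeros there makes them all
  0.\<close>

lemma mem_J_units_iff_zeros:
  assumes "d \<in> H_ring"
  shows "d \<in> J_units \<longleftrightarrow> (\<forall>s. rf_zero d (Pt s) \<longrightarrow> s \<in> C_minus) \<and> rf_at_inf d \<noteq> 0"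
proof (cases "d = 0")
  case False
  with assms have "rf_at_inf d = 0 \<longleftrightarrow> 0 < val d PtInf"
    by (intro val_zero_iff_at_inf) (auto simp: H_ring_def)
  with False assms show ?thesis
    by (force simp: mem_J_units_iff mem_H_ring_iff rf_zero_iff C_plus_def)
qed (simp add: mem_J_units_iff)

text \<open>Turns condition (i) into membership of the Cramer quotients in \<open>H_ring\<close>.
  Comparing at zeros of \<open>d\<close> suffices, since elsewhere on \<open>C_plus\<close> the
  valuation of \<open>d\<close> is 0 and that of \<open>a\<close> is nonnegative.\<close>

lemma H_ring_quotient:
  assumes "d \<in> H_ring" "a \<in> H_ring" "d \<noteq> 0"
    and "\<And>s. s \<in> C_plus \<Longrightarrow> rf_zero d s \<Longrightarrow> rf_mult d s \<le> rf_mult a s"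
  shows "a / d \<in> H_ring"
proof (cases "a = 0")
  case False
  have "0 \<le> val (a / d) s" if "s \<in> C_plus" for s
    using assms(4)[OF that] H_ringD[OF assms(1,3) that] H_ringD[OF assms(2) False that] False assms(3)
    by (cases "0 < val d s") (simp_all add: rf_zero_iff rf_mult_eq val_divide)
  then show ?thesis by (simp add: mem_H_ring_iff)
qed simp

section \<open>Divisibility and coprimeness in \<open>H_ring\<close>\<close>

lemma H_dvdI:
  assumes "d \<noteq> 0" "\<And>s. x \<noteq> 0 \<Longrightarrow> s \<in> C_plus \<Longrightarrow> val d s \<le> val x s"
  shows "H_dvd d x"
proof -
  have "x / d \<in> H_ring"
    using assms by (cases "x = 0") (auto simp: mem_H_ring_iff val_divide)
  then show ?thesis
    unfolding H_dvd_def using assms(1) by force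
qed

text \<open>The only root of \<open>s + 1\<close> lies in the open left half plane, so dividing by
  its powers adjusts the relative degree without touching finite points of
  \<open>C_plus\<close>.\<close>

lemma pval_X_plus_1:
  assumes "0 \<le> Re z"
  shows "pval ([:1, 1:] ^ n) (Pt z) = 0"
proof (induction n)
  case (Suc n)
  have "z \<noteq> -1" using assms by auto
  then have "1 + z \<noteq> 0" by (metis add.commute add_eq_0_iff)
  then have "pval [:1, 1:] (Pt z) = 0"
    by (simp add: map_poly_pCons order_0I)
  with Suc show ?case
    by (subst power_Suc, subst pval_mult) (simp_all del: pval.simps)
qed (simp add: cpoly_1)

text \<open>
  The greatest common divisor of the two numerators, divided by a power of \<open>s + 1\<close> to make it
  biproper, is a common divisor in \<open>H_ring\<close>; it detects the common zeros in the finite plane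
  without splitting into real and complex conjugate pairs of points.
\<close>

lemma H_coprime_imp_no_common_zero:
  assumes "x \<in> H_ring" "y \<in> H_ring" "y \<noteq> 0" "H_coprime x y" "s \<in> C_plus"
  shows "\<not> (rf_zero x s \<and> rf_zero y s)"
proof
  assume zero: "rf_zero x s \<and> rf_zero y s"
  \<comment> \<open>It remains to exhibit a common divisor that is not a unit because its valuation
    at \<open>s\<close> is nonzero.\<close>
  have contra: False 
    if "d \<in> H_ring" "d \<noteq> 0" "val d s \<noteq> 0"
      and "\<And>f t. f \<in> {x, y} \<Longrightarrow> f \<noteq> 0 \<Longrightarrow> t \<in> C_plus \<Longrightarrow> val d t \<le> val f t" for d
  proof -
    have "H_dvd d x" "H_dvd d y"
      using that by (auto intro!: H_dvdI)
    with assms(4) that(1) have "d \<in> J_units" by (simp add: H_coprime_def)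
    with that(3) assms(5) show False by (simp add: mem_J_units_iff)
  qed
  show False
  proof (cases s)
    case (Pt z)
    define p where "p = gcd (rf_num x) (rf_num y)"
    define e :: "real poly" where "e = [:1, 1:] ^ degree p"
    define d where "d = to_fract p / to_fract e"
    have p: "p \<noteq> 0" and e: "e \<noteq> 0" using assms(3) by (simp_all add: p_def e_def)
    have val_fin: "val d (Pt t) = int (order t (cpoly p))" if "Pt t \<in> C_plus" for t
    proof -
      have "0 \<le> Re t" using that by (auto simp: C_plus_def C_minus_def)
      from pval_X_plus_1[OF this, of "degree p"] p e show ?thesis
        by (simp add: d_def val_quot e_def)
    qed
    have val_inf: "val d PtInf = 0"
      using p e by (simp add: d_def val_quot e_def degree_power_eq)
    have val_nonneg: "0 \<le> val d t" if "t \<in> C_plus" for t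
      using that val_fin val_inf by (cases t) auto
    have "poly (cpoly p) z = 0"
      using zero by (simp add: Pt p_def poly_cpoly_gcd_eq_0 rf_zero.simps)
    show False
    proof (rule contra)
      show "d \<noteq> 0" using p e by (simp add: d_def)
      show "d \<in> H_ring" using val_nonneg by (simp add: mem_H_ring_iff)
      show "val d s \<noteq> 0"
        using assms(5) val_fin \<open>poly (cpoly p) z = 0\<close> p order_cpoly_eq_0_iff[of p z] by (simp add: Pt)
      fix f t assume f: "f \<in> {x, y}" "f \<noteq> 0" and t: "t \<in> C_plus"
      have fH: "f \<in> H_ring" using f assms by auto
      show "val d t \<le> val f t"
      proof (cases t)
        case (Pt w)
        have "p dvd rf_num f" using f by (auto simp: p_def)
        then obtain q where "rf_num f = p * q" ..
        then have "cpoly p dvd cpoly (rf_num f)"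
          by (simp add: cpoly_mult)
        then have "order w (cpoly p) \<le> order w (cpoly (rf_num f))"
          by (rule dvd_imp_order_le[rotated]) (simp add: cpoly_eq_0_iff f)
        moreover have "order w (cpoly (rf_den f)) = 0"
          using order_num_or_den[OF f(2), of w] H_ringD[OF fH f(2) t] by (auto simp: val_def Pt)
        ultimately show ?thesis
          using t val_fin by (simp add: Pt val_def)
      next
        case PtInf
        with H_ringD[OF fH f(2) t] val_inf show ?thesis by simp
      qed
    qed
  next
    case PtInf
    \<comment> \<open>The function \<open>1 / (s + 1)\<close> has a simple zero at infinity and
      valuation 0 at the finite points of \<open>C_plus\<close>.\<close>
    define d where "d = to_fract 1 / to_fract ([:1, 1:] :: real poly)"
    have val_fin: "val d (Pt t) = 0" if "Pt t \<in> C_plus" for t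
    proof -
      have "0 \<le> Re t" using that by (auto simp: C_plus_def C_minus_def)
      from pval_X_plus_1[OF this, of 1] show ?thesis
        using val_quot[of 1 "[:1, 1:]" "Pt t"] by (simp add: d_def cpoly_1)
    qed
    have val_inf: "val d PtInf = 1"
      using val_quot[of 1 "[:1, 1:]" PtInf] by (simp add: d_def)
    have val_nonneg: "0 \<le> val d t" if "t \<in> C_plus" for t
      using that val_fin val_inf by (cases t) auto
    show False
    proof (rule contra)
      show "d \<noteq> 0" by (simp add: d_def)
      show "d \<in> H_ring" using val_nonneg by (simp add: mem_H_ring_iff)
      show "val d s \<noteq> 0" by (simp add: PtInf val_inf)
      fix f t assume f: "f \<in> {x, y}" "f \<noteq> 0" and t: "t \<in> C_plus"
      have fH: "f \<in> H_ring" using f assms by auto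
      show "val d t \<le> val f t"
      proof (cases t)
        case (Pt w)
        with H_ringD[OF fH f(2) t] val_fin t show ?thesis by simp
      next
        case 2: PtInf
        from f(1) zero have "rf_zero f s" by auto
        then have "0 < val f s" using f(2) by (simp add: rf_zero_iff)
        then show ?thesis by (simp add: PtInf 2 val_inf)
      qed
    qed
  qed
qed

section \<open>Coprime factorizations and stabilization\<close>

lemma coprime_factorizationD:
  assumes "coprime_factorization p x y"
  shows "x \<in> H_ring" "y \<in> H_ring" "H_coprime x y" "rf_at_inf y \<noteq> 0" "p = x / y" "y \<noteq> 0"
  using assms by (auto simp: coprime_factorization_def)

text \<open>At each point of \<open>C_plus\<close>, coprimeness says that the smaller of the
  valuations of \<open>x\<close> and \<open>y\<close> is 0, and likewise for \<open>x'\<close> and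
  \<open>y'\<close>. With \<open>x * y' = x' * y\<close> this forces \<open>y\<close> and
  \<open>y'\<close> to have equal valuations, so \<open>y' / y\<close> is a unit.\<close>

lemma coprime_factorization_unique:
  assumes "coprime_factorization p x y" "coprime_factorization p x' y'"
  obtains u where "u \<in> J_units" "x' = u * x" "y' = u * y"
proof -
  note A = coprime_factorizationD[OF assms(1)] and B = coprime_factorizationD[OF assms(2)]
  have eq: "x / y = x' / y'" using A(5) B(5) by simp
  then have cross: "x * y' = x' * y" using A(6) B(6) by (simp add: frac_eq_eq)
  define u where "u = y' / y"
  have "val y' s = val y s" if s: "s \<in> C_plus" for s
  proof (cases "x = 0")
    \<comment> \<open>The zero function vanishes everywhere, so both denominators must have
      valuation 0 at \<open>s\<close>.\<close>
    case True
    then have "x' = 0" using cross A(6) by simp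
    with True H_coprime_imp_no_common_zero[OF A(1,2,6,3) s] H_coprime_imp_no_common_zero[OF B(1,2,6,3) s]
      H_ringD[OF A(2,6) s] H_ringD[OF B(2,6) s] A(6) B(6)
    show ?thesis by (simp add: rf_zero_iff)
  next
    case False
    then have x': "x' \<noteq> 0" using cross B(6) by auto
    have "val x s + val y' s = val x' s + val y s"
      using arg_cong[OF cross, of "\<lambda>f. val f s"] False x' A(6) B(6) by (simp add: val_mult)
    with H_coprime_imp_no_common_zero[OF A(1,2,6,3) s] H_coprime_imp_no_common_zero[OF B(1,2,6,3) s]
      H_ringD[OF A(2,6) s] H_ringD[OF B(2,6) s] H_ringD[OF A(1) False s] H_ringD[OF B(1) x' s]
      A(6) B(6) False x'
    show ?thesis by (auto simp: rf_zero_iff)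
  qed
  then have "u \<in> J_units"
    using A(6) B(6) by (simp add: u_def mem_J_units_iff val_divide)
  moreover have "x' = u * x" "y' = u * y"
    using cross A(6) by (simp_all add: u_def field_simps)
  ultimately show thesis by (rule that)
qed

text \<open>The definition only provides some pair of factorizations; by uniqueness, passing to the
  given ones divides the closed-loop denominator by a unit.\<close>

lemma stabilizesD:
  assumes "stabilizes k p" "coprime_factorization k xc yc" "coprime_factorization p x y"
  shows "y * yc + x * xc \<in> J_units"
proof -
  obtain xc' yc' x' y' where cf: "coprime_factorization k xc' yc'" "coprime_factorization p x' y'"
    and d: "\<forall>s. rf_zero (y' * yc' + x' * xc') (Pt s) \<longrightarrow> s \<in> C_minus"
      "rf_at_inf (y' * yc' + x' * xc') \<noteq> 0"
    using assms(1) unfolding stabilizes_def Let_def by blast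
  have "y' * yc' + x' * xc' \<in> H_ring"
    using coprime_factorizationD[OF cf(1)] coprime_factorizationD[OF cf(2)]
    by (intro H_ring_add H_ring_mult)
  with d have J: "y' * yc' + x' * xc' \<in> J_units"
    by (simp add: mem_J_units_iff_zeros)
  obtain u where u: "u \<in> J_units" "xc' = u * xc" "yc' = u * yc"
    using coprime_factorization_unique[OF assms(2) cf(1)] .
  obtain v where v: "v \<in> J_units" "x' = v * x" "y' = v * y"
    using coprime_factorization_unique[OF assms(3) cf(2)] .
  have "y' * yc' + x' * xc' = (u * v) * (y * yc + x * xc)"
    by (simp add: u v algebra_simps)
  moreover have "u \<noteq> 0" "v \<noteq> 0" using u v by (auto simp: mem_J_units_iff)
  ultimately have "y * yc + x * xc = (y' * yc' + x' * xc') / (u * v)"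
    by simp
  with J_units_divide[OF J J_units_mult[OF u(1) v(1)]] show ?thesis by simp
qed

text \<open>A Bezout argument: a common divisor of \<open>xc\<close> and \<open>yc\<close> divides
  the unit \<open>y * yc + x * xc\<close>.\<close>

lemma coprime_factorization_compensator:
  assumes "xc \<in> H_ring" "yc \<in> H_ring" "rf_at_inf yc \<noteq> 0"
    and "x \<in> H_ring" "y \<in> H_ring" "y * yc + x * xc \<in> J_units"
  shows "coprime_factorization (xc / yc) xc yc"
proof -
  have "d \<in> J_units" if d: "d \<in> H_ring" "H_dvd d xc" "H_dvd d yc" for d
  proof -
    obtain a b where ab: "a \<in> H_ring" "b \<in> H_ring" "xc = d * a" "yc = d * b"
      using d(2,3) unfolding H_dvd_def by blast
    have "y * yc + x * xc = d * (y * b + x * a)"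
      by (simp add: ab algebra_simps)
    with assms d(1) ab show ?thesis
      using J_units_factor[of d "y * b + x * a"] by (simp add: H_ring_add H_ring_mult)
  qed
  with assms show ?thesis
    by (simp add: coprime_factorization_def H_coprime_def)
qed

lemma stabilizesI:
  assumes "coprime_factorization k xc yc" "coprime_factorization p x y"
    and "y * yc + x * xc \<in> J_units"
  shows "stabilizes k p"
  using assms mem_J_units_iff_zeros[OF J_units_imp_H_ring[OF assms(3)]]
  unfolding stabilizes_def Let_def by blast

section \<open>Openness of the group of units\<close>

text \<open>Boundedness of a stable proper function on the closed right half plane, by induction on
  the degree of the denominator. Splitting off a root \<open>a\<close> gives
  \<open>d = (s - a) * d'\<close> and \<open>n = (s - a) * q + c\<close>; the induction hypothesis
  controls \<open>q\<close>, and the distance of \<open>a\<close> from the half plane controls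
  \<open>c\<close>.\<close>

lemma poly_bounded_by_left_stable:
  fixes n d :: "complex poly"
  assumes "\<And>s. poly d s = 0 \<Longrightarrow> Re s < 0" "degree n \<le> degree d"
  shows "\<exists>K. \<forall>s. 0 \<le> Re s \<longrightarrow> norm (poly n s) \<le> K * norm (poly d s)"
  using assms
proof (induction "degree d" arbitrary: d n)
  case 0
  then obtain b c where bc: "d = [:b:]" "n = [:c:]"
    by (metis degree_eq_zeroE le_zero_eq)
  \<comment> \<open>The zero constant would have the root 0, which is not in the open left half
    plane.\<close>
  with 0 have "b \<noteq> 0" using 0(2)[of 0] by auto
  then show ?case by (intro exI[of _ "norm c / norm b"]) (simp add: bc)
next
  case (Suc m)
  have "\<not> constant (poly d)"
    using Suc.hyps(2) by (simp add: constant_degree)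
  then obtain a where a: "poly d a = 0"
    using fundamental_theorem_of_algebra by blast
  define d' where "d' = synthetic_div d a"
  define q where "q = synthetic_div n a"
  define c where "c = poly n a"
  have d: "d = [:-a, 1:] * d'"
    using synthetic_div_correct'[of a d] a by (simp add: d'_def)
  have n: "n = [:-a, 1:] * q + [:c:]"
    using synthetic_div_correct'[of a n] by (simp add: q_def c_def)
  have m: "m = degree d'"
    using Suc.hyps(2) by (simp add: d'_def degree_synthetic_div)
  have roots: "Re s < 0" if "poly d' s = 0" for s
    using Suc.prems(1)[of s] that by (simp add: d)
  have "degree q \<le> degree d'"
    using Suc.prems(2) by (simp add: q_def d'_def degree_synthetic_div)
  from Suc.hyps(1)[OF m roots this] obtain K
    where K: "norm (poly q s) \<le> K * norm (poly d' s)" if "0 \<le> Re s" for s by blast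
  \<comment> \<open>Applied to the numerator 1, the induction hypothesis bounds \<open>d'\<close>
    away from 0.\<close>
  from Suc.hyps(1)[OF m roots, of 1] obtain L
    where L: "1 \<le> L * norm (poly d' s)" if "0 \<le> Re s" for s by auto
  have "Re a < 0" using Suc.prems(1) a by blast
  \<comment> \<open>The summand \<open>K\<close> accounts for \<open>(s - a) * q\<close>. The other
    accounts for the remainder \<open>c\<close>, through \<open>1 \<le> L * norm (poly d' s)\<close>
    and \<open>1 \<le> norm (s - a) / (- Re a)\<close>.\<close>
  have "norm (poly n s) \<le> (K + norm c * L / (- Re a)) * norm (poly d s)" if s: "0 \<le> Re s" for s
  proof -
    have sa: "- Re a \<le> norm (s - a)"
      using complex_Re_le_cmod[of "s - a"] s by simp
    have "poly d s = (s - a) * poly d' s"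
      by (simp add: d algebra_simps)
    then have norm_d: "norm (poly d s) = norm (s - a) * norm (poly d' s)"
      by (simp add: norm_mult)
    have "1 \<le> norm (s - a) / (- Re a)"
      using sa \<open>Re a < 0\<close> by (subst le_divide_eq) simp
    with mult_mono[OF L[OF s] this] L[OF s]
    have "1 \<le> L * norm (poly d' s) * (norm (s - a) / (- Re a))"
      by simp
    then have "norm c \<le> norm c * (L * norm (poly d' s) * (norm (s - a) / (- Re a)))"
      by (metis mult_left_mono mult.right_neutral norm_ge_zero)
    also have "\<dots> = norm c * L / (- Re a) * norm (poly d s)"
      by (simp add: norm_d mult_ac)
    finally have c_le: "norm c \<le> norm c * L / (- Re a) * norm (poly d s)" .
    have "norm (poly n s) \<le> norm (s - a) * norm (poly q s) + norm c"
    proof -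
      have "poly n s = (s - a) * poly q s + c"
        by (simp add: n algebra_simps)
      with norm_triangle_ineq[of "(s - a) * poly q s" c] show ?thesis
        by (simp add: norm_mult)
    qed
    also have "norm (s - a) * norm (poly q s) \<le> norm (s - a) * (K * norm (poly d' s))"
      by (intro mult_left_mono K s) simp
    also have "\<dots> = K * norm (poly d s)"
      by (simp add: norm_d mult_ac)
    finally show ?thesis using c_le unfolding distrib_right by linarith
  qed
  then show ?case by blast
qed

text \<open>With \<open>f = n / d\<close> the function is \<open>(d + c * n) / d\<close>. For small
  \<open>c\<close> the term \<open>c * n\<close> is dominated by \<open>d\<close> on the closed
  right half plane, and the coefficient at \<open>degree d\<close> does not cancel, so neither
  finite zeros nor a zero at infinity appear.\<close>

lemma J_units_one_plus_small:
  assumes "f \<in> H_ring"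
  obtains e where "0 < e" "\<And>c. \<bar>c\<bar> < e \<Longrightarrow> 1 + rf_const c * f \<in> J_units"
proof -
  define n d where "n = rf_num f" and "d = rf_den f"
  have d: "d \<noteq> 0" by (simp add: d_def)
  have deg: "degree n \<le> degree d"
    using assms by (simp add: n_def d_def H_ring_def rf_proper_def)
  have roots: "Re s < 0" if "poly (cpoly d) s = 0" for s
    using assms that by (auto simp: d_def H_ring_def rf_pole_def C_minus_def)
  from poly_bounded_by_left_stable[of "cpoly d" "cpoly n"] roots deg obtain K
    where K: "norm (poly (cpoly n) s) \<le> K * norm (poly (cpoly d) s)" if "0 \<le> Re s" for s
    by (auto simp: degree_cpoly)
  define l where "l = coeff n (degree d)"
  \<comment> \<open>The first bound excludes finite zeros, the second keeps the degree of
    \<open>d + c * n\<close>. The added 1 avoids division by 0, and the absolute value of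
    \<open>K\<close> is taken because its sign is unknown.\<close>
  define e where "e = min (1 / (\<bar>K\<bar> + 1)) (\<bar>lead_coeff d\<bar> / (\<bar>l\<bar> + 1))"
  show thesis
  proof
    show "0 < e" using d by (simp add: e_def)
    fix c :: real assume c: "\<bar>c\<bar> < e"
    define q where "q = d + smult c n"
    have cK: "\<bar>c\<bar> * (\<bar>K\<bar> + 1) < 1" and cl: "\<bar>c\<bar> * (\<bar>l\<bar> + 1) < \<bar>lead_coeff d\<bar>"
      using c by (simp_all add: e_def less_divide_eq)
    have "\<bar>c * l\<bar> < \<bar>lead_coeff d\<bar>"
      using cl by (simp add: abs_mult algebra_simps)
    then have "coeff q (degree d) \<noteq> 0"
      by (auto simp: q_def l_def)
    then have "q \<noteq> 0" "degree d \<le> degree q"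
      by (auto intro: le_degree)
    moreover have "degree q \<le> degree d"
      unfolding q_def using deg degree_smult_le[of c n] by (intro degree_add_le) simp_all
    ultimately have degq: "degree q = degree d" by simp
    have nz: "poly (cpoly q) s \<noteq> 0" if s: "0 \<le> Re s" for s
    proof
      assume "poly (cpoly q) s = 0"
      then have "poly (cpoly d) s = - (of_real c * poly (cpoly n) s)"
        by (simp add: q_def cpoly_add cpoly_smult add_eq_0_iff2)
      then have "norm (poly (cpoly d) s) = \<bar>c\<bar> * norm (poly (cpoly n) s)"
        by (simp add: norm_mult)
      also have "\<dots> \<le> \<bar>c\<bar> * (\<bar>K\<bar> * norm (poly (cpoly d) s))"
        by (intro mult_left_mono order_trans[OF K[OF s]] mult_right_mono) auto
      finally have "(1 - \<bar>c\<bar> * \<bar>K\<bar>) * norm (poly (cpoly d) s) \<le> 0"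
        by (simp add: algebra_simps)
      moreover have "0 < 1 - \<bar>c\<bar> * \<bar>K\<bar>"
        using cK by (simp add: algebra_simps)
      moreover have "0 < norm (poly (cpoly d) s)"
        using roots[of s] s by force
      ultimately show False
        by (meson mult_pos_pos not_le)
    qed
    have "1 + rf_const c * f = to_fract q / to_fract d"
    proof -
      have "f = to_fract n / to_fract d" by (simp add: n_def d_def rf_eq)
      moreover have "to_fract q = to_fract d + rf_const c * to_fract n"
        by (simp add: q_def rf_const_def flip: to_fract_mult)
      ultimately show ?thesis using d by (simp add: add_divide_distrib)
    qed
    moreover have "val (to_fract q / to_fract d) s = 0" if "s \<in> C_plus" for s
    proof (cases s)
      case (Pt z)
      with that have "0 \<le> Re z" by (auto simp: C_plus_def C_minus_def)
      then have "poly (cpoly q) z \<noteq> 0" "poly (cpoly d) z \<noteq> 0"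
        using nz[of z] roots[of z] by auto
      with d \<open>q \<noteq> 0\<close> show ?thesis
        by (simp add: Pt val_quot order_0I)
    qed (use d \<open>q \<noteq> 0\<close> degq in \<open>simp add: val_quot\<close>)
    ultimately show "1 + rf_const c * f \<in> J_units"
      using d \<open>q \<noteq> 0\<close> by (simp add: mem_J_units_iff)
  qed
qed

text \<open>Factoring out \<open>u\<close> reduces this to a perturbation of 1 in the direction
  \<open>f / u\<close>, which lies in \<open>H_ring\<close>.\<close>

lemma J_units_perturb:
  assumes "u \<in> J_units" "f \<in> H_ring"
  obtains e where "0 < e" "\<And>c. \<bar>c\<bar> < e \<Longrightarrow> u + rf_const c * f \<in> J_units"
proof -
  have u: "u \<noteq> 0" "1 / u \<in> H_ring"
    using assms(1) by (auto simp: mem_J_units_iff mem_H_ring_iff val_divide)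
  obtain e where e: "0 < e" "\<And>c. \<bar>c\<bar> < e \<Longrightarrow> 1 + rf_const c * (f * (1 / u)) \<in> J_units"
    using J_units_one_plus_small[OF H_ring_mult[OF assms(2) u(2)]] by blast
  have "u + rf_const c * f \<in> J_units" if "\<bar>c\<bar> < e" for c
  proof -
    have "u + rf_const c * f = u * (1 + rf_const c * (f * (1 / u)))"
      using u(1) by (simp add: field_simps)
    with J_units_mult[OF assms(1) e(2)[OF that]] show ?thesis by simp
  qed
  with e(1) show thesis by (rule that)
qed

section \<open>Values at infinity and the two directions of the equivalence\<close>

lemma rf_at_inf_eq_0_iff: "f \<in> H_ring \<Longrightarrow> rf_at_inf f = 0 \<longleftrightarrow> f = 0 \<or> 0 < val f PtInf"
  by (cases "f = 0") (simp_all add: val_zero_iff_at_inf H_ring_def)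

text \<open>Otherwise the constant \<open>c\<close> would be the sum of \<open>f + c\<close> and
  \<open>- f\<close>, both vanishing at infinity, whereas its valuation there is 0.\<close>

lemma rf_at_inf_add_const:
  assumes "f \<in> H_ring" "rf_at_inf f = 0" "c \<noteq> 0"
  shows "rf_at_inf (f + rf_const c) \<noteq> 0"
proof
  define g where "g = f + rf_const c"
  define h where "h = rf_const (-1) * f"
  assume "rf_at_inf (f + rf_const c) = 0"
  moreover have "g \<in> H_ring"
    using assms(1) by (simp add: g_def H_ring_add H_ring_const)
  ultimately have g: "g = 0 \<or> 0 < val g PtInf"
    using rf_at_inf_eq_0_iff[of g] by (simp add: g_def)
  have f: "f = 0 \<or> 0 < val f PtInf"
    using assms by (simp add: rf_at_inf_eq_0_iff)
  have h: "h = 0 \<or> 0 < val h PtInf"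
    using f by (cases "f = 0") (simp_all add: h_def val_mult val_const)
  have "g + h = rf_const c"
    by (simp add: g_def h_def rf_const_minus_1)
  then have "g + h \<noteq> 0" "val (g + h) PtInf = 0"
    using assms(3) by (simp_all add: val_const)
  with g h val_add_ge[of g h PtInf] show False
    by (cases "g = 0"; cases "h = 0") auto
qed

text \<open>For the necessity of (i) and (ii): multiplying \<open>D\<close> by an element of
  \<open>H_ring\<close> cannot lower valuations on \<open>C_plus\<close>, and \<open>yc\<close> has
  valuation 0 at infinity.\<close>

lemma stabilizing_units_imp_conditions:
  assumes "D \<in> H_ring" "D \<noteq> 0" "xc \<in> H_ring" "yc \<in> H_ring" "rf_at_inf yc \<noteq> 0"
    and "s \<in> C_plus" "rf_zero D s"
  shows "rf_zero (D * xc) s" "rf_mult D s \<le> rf_mult (D * xc) s"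
    and "rf_zero (D * yc) s" "rf_mult D s \<le> rf_mult (D * yc) s"
    and "s = PtInf \<Longrightarrow> rf_mult (D * yc) s = rf_mult D s"
proof -
  have *: "rf_zero (D * f) s \<and> rf_mult D s \<le> rf_mult (D * f) s" if "f \<in> H_ring" for f
  proof (cases "f = 0")
    case True
    then show ?thesis by (cases s) (simp_all add: rf_zero_iff rf_mult.simps)
  next
    case False
    with H_ringD[OF that False assms(6)] assms(2,7) show ?thesis
      by (simp add: rf_zero_iff rf_mult_eq val_mult)
  qed
  show "rf_zero (D * xc) s" "rf_mult D s \<le> rf_mult (D * xc) s"
    "rf_zero (D * yc) s" "rf_mult D s \<le> rf_mult (D * yc) s"
    using *[OF assms(3)] *[OF assms(4)] by auto
  show "rf_mult (D * yc) s = rf_mult D s" if "s = PtInf"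
  proof -
    have yc: "yc \<noteq> 0" "\<not> 0 < val yc s"
      using assms(4,5) that by (auto simp: rf_at_inf_eq_0_iff)
    with H_ringD[OF assms(4) yc(1) assms(6)] have "val yc s = 0" by simp
    with yc(1) assms(2) show ?thesis by (simp add: rf_mult_eq val_mult)
  qed
qed

text \<open>
  If the determinant does not vanish at infinity, the conditions leave the value of \<open>yc\<close> at
  infinity free, so the solution of the linear system may be an improper compensator.
  Adding a small constant to \<open>yc\<close> repairs this, since the units of \<open>H_ring\<close> are open.
\<close>

lemma proper_perturbation:
  assumes "xc \<in> H_ring" "yc \<in> H_ring" "y0 \<in> H_ring" "y1 \<in> H_ring"
    and "y0 * yc + x0 * xc \<in> J_units" "y1 * yc + x1 * xc \<in> J_units"
  obtains yc' where "yc' \<in> H_ring" "rf_at_inf yc' \<noteq> 0"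
    "y0 * yc' + x0 * xc \<in> J_units" "y1 * yc' + x1 * xc \<in> J_units"
proof (cases "rf_at_inf yc = 0")
  case True
  \<comment> \<open>Replacing \<open>yc\<close> by \<open>yc + c\<close> changes the two closed-loop
    denominators by \<open>c * y0\<close> and \<open>c * y1\<close>, hence these directions of
    perturbation.\<close>
  obtain e0 where e0: "0 < e0" "\<And>c. \<bar>c\<bar> < e0 \<Longrightarrow> (y0 * yc + x0 * xc) + rf_const c * y0 \<in> J_units"
    using J_units_perturb[OF assms(5,3)] by blast
  obtain e1 where e1: "0 < e1" "\<And>c. \<bar>c\<bar> < e1 \<Longrightarrow> (y1 * yc + x1 * xc) + rf_const c * y1 \<in> J_units"
    using J_units_perturb[OF assms(6,4)] by blast
  define c where "c = min e0 e1 / 2"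
  have c: "c \<noteq> 0" "\<bar>c\<bar> < e0" "\<bar>c\<bar> < e1" using e0(1) e1(1) by (auto simp: c_def)
  show thesis
  proof (rule that)
    show "yc + rf_const c \<in> H_ring" by (intro H_ring_add assms H_ring_const)
    show "rf_at_inf (yc + rf_const c) \<noteq> 0" by (rule rf_at_inf_add_const[OF assms(2) True c(1)])
    show "y0 * (yc + rf_const c) + x0 * xc \<in> J_units"
      using e0(2)[OF c(2)] by (simp add: algebra_simps)
    show "y1 * (yc + rf_const c) + x1 * xc \<in> J_units"
      using e1(2)[OF c(3)] by (simp add: algebra_simps)
  qed
next
  case False
  with assms show thesis by (intro that[of yc])
qed

theorem proposition1:
  fixes p0 p1 x0 y0 x1 y1 :: ratfun
  assumes "coprime_factorization p0 x0 y0"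
    and "coprime_factorization p1 x1 y1"
    and "p0 \<noteq> p1"
  shows "(\<exists>k. proper_compensator k \<and> stabilizes k p0 \<and> stabilizes k p1) \<longleftrightarrow>
    (\<exists>\<delta>0\<in>J_units. \<exists>\<delta>1\<in>J_units.
       (\<forall>s\<in>C_plus. rf_zero (x0 * y1 - x1 * y0) s \<longrightarrow>
          rf_zero (\<delta>0 * y1 - \<delta>1 * y0) s \<and>
          rf_mult (x0 * y1 - x1 * y0) s \<le> rf_mult (\<delta>0 * y1 - \<delta>1 * y0) s \<and>
          rf_zero (\<delta>1 * x0 - \<delta>0 * x1) s \<and>
          rf_mult (x0 * y1 - x1 * y0) s \<le> rf_mult (\<delta>1 * x0 - \<delta>0 * x1) s) \<and>
       (rf_zero (x0 * y1 - x1 * y0) PtInf \<longrightarrow>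
          rf_zero (\<delta>1 * x0 - \<delta>0 * x1) PtInf \<and>
          rf_mult (\<delta>1 * x0 - \<delta>0 * x1) PtInf = rf_mult (x0 * y1 - x1 * y0) PtInf))"
    (is "?stabilizable \<longleftrightarrow> (\<exists>\<delta>0\<in>J_units. \<exists>\<delta>1\<in>J_units. ?conds \<delta>0 \<delta>1)")
proof -
  note F0 = coprime_factorizationD[OF assms(1)] and F1 = coprime_factorizationD[OF assms(2)]
  define D where "D = x0 * y1 - x1 * y0"
  have D: "D \<in> H_ring"
    unfolding D_def by (intro H_ring_diff H_ring_mult F0 F1)
  \<comment> \<open>The determinant vanishes only if the two plants coincide.\<close>
  have "D \<noteq> 0"
    using assms(3) F0(5,6) F1(5,6) by (simp add: D_def frac_eq_eq)
  show ?thesis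
  proof
    assume ?stabilizable
    then obtain k xc yc where k: "coprime_factorization k xc yc" "stabilizes k p0" "stabilizes k p1"
      by (auto simp: proper_compensator_def)
    note Fc = coprime_factorizationD[OF k(1)]
    define \<delta>0 where "\<delta>0 = y0 * yc + x0 * xc"
    define \<delta>1 where "\<delta>1 = y1 * yc + x1 * xc"
    have "\<delta>0 \<in> J_units" "\<delta>1 \<in> J_units"
      using stabilizesD[OF k(2,1) assms(1)] stabilizesD[OF k(3,1) assms(2)]
      by (simp_all add: \<delta>0_def \<delta>1_def)
    moreover have eqs: "\<delta>0 * y1 - \<delta>1 * y0 = D * xc" "\<delta>1 * x0 - \<delta>0 * x1 = D * yc"
      by (simp_all add: \<delta>0_def \<delta>1_def D_def algebra_simps)
    have "?conds \<delta>0 \<delta>1"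
      unfolding eqs D_def[symmetric]
      using stabilizing_units_imp_conditions[OF D \<open>D \<noteq> 0\<close> Fc(1,2,4)]
      by (auto simp: C_plus_def)
    ultimately show "\<exists>\<delta>0\<in>J_units. \<exists>\<delta>1\<in>J_units. ?conds \<delta>0 \<delta>1" by blast
  next
    assume "\<exists>\<delta>0\<in>J_units. \<exists>\<delta>1\<in>J_units. ?conds \<delta>0 \<delta>1"
    then obtain \<delta>0 \<delta>1 where \<delta>: "\<delta>0 \<in> J_units" "\<delta>1 \<in> J_units" and conds: "?conds \<delta>0 \<delta>1"
      by blast
    define xc where "xc = (\<delta>0 * y1 - \<delta>1 * y0) / D"
    define yc where "yc = (\<delta>1 * x0 - \<delta>0 * x1) / D"
    have "xc \<in> H_ring" unfolding xc_def
      using conds by (intro H_ring_quotient D \<open>D \<noteq> 0\<close> H_ring_diff H_ring_mult F0 F1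
          J_units_imp_H_ring \<delta>) (simp add: D_def)
    moreover have "yc \<in> H_ring" unfolding yc_def
      using conds by (intro H_ring_quotient D \<open>D \<noteq> 0\<close> H_ring_diff H_ring_mult F0 F1
          J_units_imp_H_ring \<delta>) (simp add: D_def)
    \<comment> \<open>The Cramer quotients solve the linear system; multiplied by \<open>D\<close>,
      this is a polynomial identity in the \<open>x\<close>, \<open>y\<close> and
      \<open>\<delta>\<close>.\<close>
    moreover have "(y0 * yc + x0 * xc) * D = \<delta>0 * D" "(y1 * yc + x1 * xc) * D = \<delta>1 * D"
      using \<open>D \<noteq> 0\<close> by (simp_all add: xc_def yc_def distrib_right) (simp_all add: D_def algebra_simps)
    then have "y0 * yc + x0 * xc = \<delta>0" "y1 * yc + x1 * xc = \<delta>1"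
      using \<open>D \<noteq> 0\<close> by simp_all
    \<comment> \<open>Only \<open>yc\<close> is replaced. The new denominators are units but may
      differ from \<open>\<delta>0\<close> and \<open>\<delta>1\<close>.\<close>
    ultimately obtain yc' where yc': "yc' \<in> H_ring" "rf_at_inf yc' \<noteq> 0"
      "y0 * yc' + x0 * xc \<in> J_units" "y1 * yc' + x1 * xc \<in> J_units"
      using proper_perturbation[of xc yc y0 y1 x0 x1] F0 F1 \<delta> by metis
    have "coprime_factorization (xc / yc') xc yc'"
      by (rule coprime_factorization_compensator[OF \<open>xc \<in> H_ring\<close> yc'(1,2) F0(1,2) yc'(3)])
    with stabilizesI[OF this assms(1) yc'(3)] stabilizesI[OF this assms(2) yc'(4)]
    show ?stabilizable
      by (auto simp: proper_compensator_def)
  qed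
qed

end
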